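(* Let $S_4=\mathbb{C}P^1\setminus\{p_1,\dots,p_4\}$ with base point $s_0$ and loops $\gamma_1,\dots,\gamma_4$ around the punctures satisfying $\gamma_4\gamma_3\gamma_2\gamma_1=1$. Let $$g_{0,2}=\begin{pmatrix} -\tfrac{1}{2}\sqrt{1+\sqrt{5}-\sqrt{2(1+\sqrt{5})}}& \left( -\sqrt{1+\sqrt{5}-\sqrt{2(1+\sqrt{5})}}\right)^{-1} \\ \tfrac{1}{2}\sqrt{1+\sqrt{5}-\sqrt{2(1+\sqrt{5})}}& \left(-\sqrt{1+\sqrt{5}-\sqrt{2(1+\sqrt{5})}}\right)^{-1}\end{pmatrix},\quad j_0=\frac{1}{\sqrt2}\begin{pmatrix}1&-1\\1&1\end{pmatrix},$$ $J_1=-(g_{0,2})^2$, and $J_{k+1}=j_0J_kj_0^{-1}$ for $k=1,2,3$ (so that $J_4J_3J_2J_1=\mathrm{Id}$). Then the representation $\rho\colon\pi_1(S_4,s_0)\to\mathrm{SL}(2,\mathbb{C})$, $\rho(\gamma_k)=J_k$, is a genus $4$ RSR-representation whose image is contained in the cocompact lattice $\Gamma\subset\mathrm{SL}(2,\mathbb{C})$.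
   Context: Let $\mathbb{T}\subset\mathbb{H}^3$ be the hyperbolic tetrahedron with dihedral angles $\tfrac{\pi}{2},\tfrac{\pi}{2},\tfrac{\pi}{2},\tfrac{\pi}{5},\tfrac{\pi}{3},\tfrac{\pi}{4}$ (the characteristic cell of the order-4 dodecahedral honeycomb $\{5,3,4\}$), let $\mathfrak G$ be the index-2 orientation-preserving subgroup of the Coxeter group generated by the reflections in its faces, and let $\Gamma\subset\mathrm{SL}(2,\mathbb{C})$ be the preimage of $\mathfrak G$ under the double cover $\mathrm{SL}(2,\mathbb{C})\to\mathrm{SO}(3,1)$; $\Gamma$ is a cocompact lattice and $g_{0,2}\in\Gamma$ is a lift of the product of two face reflections. An irreducible representation $\rho$ of $\pi_1(S_4,s_0)$ with $M_j=\rho(\gamma_j)$ is called RSR if: (Real) it takes values in $\mathrm{SL}(2,\mathbb{R})$ and $\mathrm{tr}(M_1M_2),\mathrm{tr}(M_2M_3),\mathrm{tr}(M_1M_3)<-2$; (Symmetric) all $M_j$ lie in the conjugacy class of $\mathrm{diag}(e^{2\pi i\tilde r},e^{-2\pi i\tilde r})$ for some $\tilde r\in(\tfrac14,\tfrac12)$; (Rectangular) $\mathrm{tr}(M_1M_3)=\mathrm{tr}(M_2M_4)$. If the $M_j$ have order $k$, the genus of $\rho$ is $k-1$ for $k$ odd and $\tfrac k2-1$ for $k$ even. *)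

theory Defs
  imports "HOL-Analysis.Analysis"
begin

type_synonym cmat = "complex^2^2"

definition cI :: cmat where "cI = mat 1"

definition msc :: "complex \<Rightarrow> cmat \<Rightarrow> cmat" where
  "msc c M = (\<chi> i j. c * M$i$j)"

definition adjoint :: "cmat \<Rightarrow> cmat" where
  "adjoint M = (\<chi> i j. cnj (M$j$i))"

definition hermitian :: "cmat \<Rightarrow> bool" where
  "hermitian X \<longleftrightarrow> (\<forall>i j. X$i$j = cnj (X$j$i))"

definition in_SL2C :: "cmat \<Rightarrow> bool" where
  "in_SL2C A \<longleftrightarrow> det A = 1"

definition in_SL2R :: "cmat \<Rightarrow> bool" where
  "in_SL2R A \<longleftrightarrow> det A = 1 \<and> (\<forall>i j. A$i$j \<in> \<real>)"

fun mpow :: "cmat \<Rightarrow> nat \<Rightarrow> cmat" where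
  "mpow M 0 = cI"
| "mpow M (Suc n) = M ** mpow M n"

definition has_order :: "cmat \<Rightarrow> nat \<Rightarrow> bool" where
  "has_order M k \<longleftrightarrow> 0 < k \<and> mpow M k = cI \<and> (\<forall>n. 0 < n \<and> n < k \<longrightarrow> mpow M n \<noteq> cI)"

definition cdiag :: "complex \<Rightarrow> complex \<Rightarrow> cmat" where
  "cdiag a b = (\<chi> i j. if i = j then (if i = 1 then a else b) else 0)"

definition conjugate_mat :: "cmat \<Rightarrow> cmat \<Rightarrow> bool" where
  "conjugate_mat A B \<longleftrightarrow> (\<exists>P. invertible P \<and> A = P ** B ** matrix_inv P)"

text \<open>Representations of pi_1(S_4, s_0) = < g1,g2,g3,g4 | g4 g3 g2 g1 = 1 >,
  encoded by the images M 1, ..., M 4 of the loops.\<close>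

definition is_rep :: "(nat \<Rightarrow> cmat) \<Rightarrow> bool" where
  "is_rep M \<longleftrightarrow> (\<forall>j\<in>{1..4}. in_SL2C (M j)) \<and> M 4 ** M 3 ** M 2 ** M 1 = cI"

inductive_set rep_image :: "(nat \<Rightarrow> cmat) \<Rightarrow> cmat set" for M where
  one: "cI \<in> rep_image M"
| left: "A \<in> rep_image M \<Longrightarrow> j \<in> {1..4} \<Longrightarrow> M j ** A \<in> rep_image M"
| left_inv: "A \<in> rep_image M \<Longrightarrow> j \<in> {1..4} \<Longrightarrow> matrix_inv (M j) ** A \<in> rep_image M"

definition irreducible_rep :: "(nat \<Rightarrow> cmat) \<Rightarrow> bool" where
  "irreducible_rep M \<longleftrightarrow>
     \<not> (\<exists>v::complex^2. v \<noteq> 0 \<and> (\<forall>j\<in>{1..4}. \<exists>c. M j *v v = c *s v))"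

definition RSR :: "(nat \<Rightarrow> cmat) \<Rightarrow> bool" where
  "RSR M \<longleftrightarrow> is_rep M \<and> irreducible_rep M
     \<and> (\<comment> \<open>Real\<close>
        (\<forall>A\<in>rep_image M. in_SL2R A)
        \<and> trace (M 1 ** M 2) \<in> \<real> \<and> Re (trace (M 1 ** M 2)) < -2
        \<and> trace (M 2 ** M 3) \<in> \<real> \<and> Re (trace (M 2 ** M 3)) < -2
        \<and> trace (M 1 ** M 3) \<in> \<real> \<and> Re (trace (M 1 ** M 3)) < -2)
     \<and> (\<comment> \<open>Symmetric\<close>
        \<exists>r::real. 1/4 < r \<and> r < 1/2 \<and>
          (\<forall>j\<in>{1..4}. conjugate_mat (M j)
              (cdiag (exp (2 * pi * \<i> * of_real r)) (exp (- 2 * pi * \<i> * of_real r)))))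
     \<and> (\<comment> \<open>Rectangular\<close>
        trace (M 1 ** M 3) = trace (M 2 ** M 4))"

definition rsr_genus :: "nat \<Rightarrow> nat" where
  "rsr_genus k = (if odd k then k - 1 else k div 2 - 1)"

definition has_genus :: "(nat \<Rightarrow> cmat) \<Rightarrow> nat \<Rightarrow> bool" where
  "has_genus M g \<longleftrightarrow> (\<exists>k. (\<forall>j\<in>{1..4}. has_order (M j) k) \<and> rsr_genus k = g)"

text \<open>Minkowski space R^{3,1} modelled as 2x2 Hermitian matrices, with
  quadratic form <X,X> = - det X.  SL(2,C) acts by X |-> A X A^*,
  which is the double cover SL(2,C) -> SO^+(3,1).\<close>

definition mink :: "cmat \<Rightarrow> cmat \<Rightarrow> real" where
  "mink X Y = Re (det X + det Y - det (X + Y)) / 2"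

definition mreflect :: "cmat \<Rightarrow> cmat \<Rightarrow> cmat" where
  "mreflect N X = X - (2 * mink X N) *\<^sub>R N"

text \<open>Outward unit normals N 0..N 3 of the faces of the characteristic tetrahedron
  of {5,3,4}: Coxeter diagram 0 -5- 1 -3- 2 -4- 3, i.e. dihedral angles
  pi/5, pi/3, pi/4 between faces (0,1), (1,2), (2,3) and pi/2 otherwise.\<close>

definition tet_angle :: "nat \<Rightarrow> nat \<Rightarrow> real" where
  "tet_angle i j =
     (if {i,j} = {0,1} then pi/5 else if {i,j} = {1,2} then pi/3
      else if {i,j} = {2,3} then pi/4 else pi/2)"

definition tetrahedron_normals :: "(nat \<Rightarrow> cmat) \<Rightarrow> bool" where
  "tetrahedron_normals N \<longleftrightarrow>
     (\<forall>i<4. hermitian (N i) \<and> mink (N i) (N i) = 1) \<and>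
     (\<forall>i<4. \<forall>j<4. i \<noteq> j \<longrightarrow> mink (N i) (N j) = - cos (tet_angle i j))"

text \<open>Orientation preserving subgroup: products of an even number of face reflections.\<close>

definition refl_word :: "(nat \<Rightarrow> cmat) \<Rightarrow> nat list \<Rightarrow> cmat \<Rightarrow> cmat" where
  "refl_word N w = foldr (\<lambda>i f. mreflect (N i) \<circ> f) w id"

definition Gamma_lattice :: "(nat \<Rightarrow> cmat) \<Rightarrow> cmat set" where
  "Gamma_lattice N = {A. in_SL2C A \<and>
     (\<exists>w. set w \<subseteq> {0..<4} \<and> even (length w) \<and>
        (\<forall>X. hermitian X \<longrightarrow> A ** X ** adjoint A = refl_word N w X))}"

definition aa :: real where
  "aa = sqrt (1 + sqrt 5 - sqrt (2 * (1 + sqrt 5)))"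

definition g02 :: cmat where
  "g02 = (\<chi> i j. if i = 1 then (if j = 1 then of_real (- aa / 2) else of_real (inverse (- aa)))
                  else (if j = 1 then of_real (aa / 2) else of_real (inverse (- aa))))"

definition j0 :: cmat where
  "j0 = (\<chi> i j. of_real (1 / sqrt 2) * (if i = 1 then (if j = 1 then 1 else -1) else 1))"

fun Jmat :: "nat \<Rightarrow> cmat" where
  "Jmat 0 = cI"
| "Jmat (Suc 0) = - (g02 ** g02)"
| "Jmat (Suc (Suc k)) = j0 ** Jmat (Suc k) ** matrix_inv j0"

end

theory Submission
  imports Defs
begin

text \<open>With \<open>\<phi>\<close> the golden ratio, \<open>g02\<close> has trace \<open>-\<phi> = 2 cos (4\<pi>/5)\<close>, so \<open>J1 = - g02\<^sup>2\<close> has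
  eigenvalues \<open>exp (\<plusminus>3\<pi>i/5)\<close> and order 10; since conjugation by \<open>j0\<close> is a quarter turn, the
  \<open>Jk\<close> are the four matrices with the same trace and antisymmetric part as \<open>J1\<close> and
  traceless symmetric part \<open>(\<plusminus>m, \<plusminus>m)\<close>, where \<open>m\<^sup>2 = \<phi>/4\<close>, and all conditions on traces become
  identities in \<open>\<phi>\<close>. On Hermitian matrices the reflection in a unit normal \<open>N\<close> is
  \<open>X \<mapsto> N cof(X) N\<close>, hence the product of the reflections in \<open>M\<close> and \<open>N\<close> lifts to
  \<open>M cof(N)\<close>; for suitable normals of the tetrahedron both \<open>g02\<close> and \<open>j0\<close> are, up to sign,
  products of such lifts.\<close>

section \<open>Two by two matrices as split quaternions\<close>

text \<open>The coefficients refer to the basis \<open>1\<close>, \<open>E = [[0,-1],[1,0]]\<close>, \<open>[[1,0],[0,-1]]\<close>,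
  \<open>[[0,1],[1,0]]\<close>. Conjugation by \<open>j0\<close> fixes the first two and is a quarter turn on the others.\<close>

definition quat :: "complex \<Rightarrow> complex \<Rightarrow> complex \<Rightarrow> complex \<Rightarrow> cmat" where
  "quat c d x y = (\<chi> i j. if i = 1 then (if j = 1 then c + x else y - d)
                                  else (if j = 1 then y + d else c - x))"

lemma quat_nth [simp]:
  "quat c d x y $ 1 $ 1 = c + x" "quat c d x y $ 1 $ 2 = y - d"
  "quat c d x y $ 2 $ 1 = y + d" "quat c d x y $ 2 $ 2 = c - x"
  by (simp_all add: quat_def)

lemma quat_eqI:
  assumes "c = c'" "d = d'" "x = x'" "y = y'"
  shows "quat c d x y = quat c' d' x' y'"
  using assms by simp

lemma quat_surj:
  obtains c d x y where "M = quat c d x y"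
proof
  show "M = quat ((M$1$1 + M$2$2)/2) ((M$2$1 - M$1$2)/2) ((M$1$1 - M$2$2)/2) ((M$2$1 + M$1$2)/2)"
    by (simp add: vec_eq_iff forall_2 field_simps)
qed

lemma quat_mult:
  "quat c d x y ** quat c' d' x' y' =
     quat (c * c' - d * d' + x * x' + y * y') (c * d' + d * c' - x * y' + y * x')
          (c * x' + x * c' - d * y' + y * d') (c * y' + y * c' + d * x' - x * d')"
  by (simp add: vec_eq_iff forall_2 matrix_matrix_mult_def sum_2) (simp add: algebra_simps)

lemma det_quat: "det (quat c d x y) = c\<^sup>2 + d\<^sup>2 - x\<^sup>2 - y\<^sup>2"
  by (simp add: det_2 power2_eq_square algebra_simps)

lemma trace_quat: "trace (quat c d x y) = 2 * c"
  by (simp add: trace_def sum_2)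

lemma quat_add: "quat c d x y + quat c' d' x' y' = quat (c + c') (d + d') (x + x') (y + y')"
  by (simp add: vec_eq_iff forall_2 algebra_simps)

lemma quat_diff: "quat c d x y - quat c' d' x' y' = quat (c - c') (d - d') (x - x') (y - y')"
  by (simp add: vec_eq_iff forall_2 algebra_simps)

lemma quat_uminus: "- quat c d x y = quat (- c) (- d) (- x) (- y)"
  by (simp add: vec_eq_iff forall_2 algebra_simps)

lemma cI_quat: "cI = quat 1 0 0 0"
  by (simp add: vec_eq_iff forall_2 cI_def mat_def)

lemma adjoint_quat: "adjoint (quat c d x y) = quat (cnj c) (- cnj d) (cnj x) (cnj y)"
  by (simp add: vec_eq_iff forall_2 adjoint_def)

text \<open>The adjugate, in the form \<open>trace A\<close> times the identity minus
  \<open>A\<close>. On \<open>quat\<close> it is the conjugation of split quaternions, hence it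
  reverses products.\<close>

definition cof :: "cmat \<Rightarrow> cmat" where
  "cof A = (\<chi> i j. if i = j then trace A - A$i$j else - A$i$j)"

lemma matrix_diff_mult: "(A - B) ** C = A ** C - B ** (C :: cmat)"
  by (simp add: vec_eq_iff forall_2 matrix_matrix_mult_def sum_2 algebra_simps)

lemma cof_quat: "cof (quat c d x y) = quat c (- d) (- x) (- y)"
  by (simp add: vec_eq_iff forall_2 cof_def trace_quat)

lemma cof_cof [simp]: "cof (cof A) = A"
  by (rule quat_surj[of A]) (simp add: cof_quat)

lemma cof_mult: "cof (A ** B) = cof B ** cof A"
  by (rule quat_surj[of A], rule quat_surj[of B])
     (simp add: cof_quat quat_mult algebra_simps)

lemma det_cof [simp]: "det (cof A) = det A"
  by (rule quat_surj[of A]) (simp add: cof_quat det_quat)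

lemma adjoint_cof: "adjoint (cof A) = cof (adjoint A)"
  by (rule quat_surj[of A]) (simp add: cof_quat adjoint_quat)

lemma hermitian_iff_adjoint: "hermitian X \<longleftrightarrow> adjoint X = X"
  unfolding hermitian_def by (simp add: adjoint_def vec_eq_iff eq_commute)

lemma cI_mult [simp]: "cI ** A = A" "A ** cI = A"
  by (simp_all add: cI_def)

lemma adjoint_mult: "adjoint (A ** B) = adjoint B ** adjoint A"
  by (simp add: vec_eq_iff adjoint_def matrix_matrix_mult_def mult.commute)

lemma adjoint_adjoint [simp]: "adjoint (adjoint A) = A"
  by (simp add: vec_eq_iff adjoint_def)

lemma hermitian_congruence: "hermitian X \<Longrightarrow> hermitian (A ** X ** adjoint A)"
  by (simp add: hermitian_iff_adjoint adjoint_mult matrix_mul_assoc)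

lemma matrix_inv_eqI:
  fixes A B :: cmat
  assumes "A ** B = cI"
  shows "matrix_inv A = B"
proof -
  have BA: "B ** A = cI"
    using assms matrix_left_right_inverse[of A B] by (simp add: cI_def)
  have "invertible A"
    using assms BA by (auto simp: invertible_def cI_def)
  then have "A ** matrix_inv A = cI"
    unfolding invertible_def matrix_inv_def cI_def by (rule someI2_ex) simp
  then have "B ** (A ** matrix_inv A) = B" by simp
  then show ?thesis
    by (simp add: matrix_mul_assoc BA)
qed

lemma mult_cof: "A ** cof A = quat (det A) 0 0 0"
  by (rule quat_surj[of A])
     (simp add: quat_mult cof_quat det_quat power2_eq_square mult.commute)

lemma matrix_inv_cof:
  assumes "in_SL2C A"
  shows "matrix_inv A = cof A"
  by (rule matrix_inv_eqI) (use assms in \<open>simp add: mult_cof cI_quat in_SL2C_def\<close>)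

lemma in_SL2C_inv:
  assumes "in_SL2C A"
  shows "in_SL2C (matrix_inv A)" "A ** matrix_inv A = cI"
  using assms by (simp_all add: matrix_inv_cof mult_cof cI_quat in_SL2C_def)

lemma in_SL2C_mult: "in_SL2C A \<Longrightarrow> in_SL2C B \<Longrightarrow> in_SL2C (A ** B)"
  by (simp add: in_SL2C_def det_mul)

lemma in_SL2R_mult: "in_SL2R A \<Longrightarrow> in_SL2R B \<Longrightarrow> in_SL2R (A ** B)"
  unfolding in_SL2R_def det_mul by (auto simp: matrix_matrix_mult_def)

lemma in_SL2R_inv:
  assumes "in_SL2R A"
  shows "in_SL2R (matrix_inv A)"
proof -
  have "matrix_inv A = cof A"
    using assms by (simp add: in_SL2C_def in_SL2R_def matrix_inv_cof)
  moreover have "cof A $ i $ j \<in> \<real>" for i j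
    using assms by (simp add: in_SL2R_def cof_def trace_def sum_2)
  ultimately show ?thesis
    using assms by (simp add: in_SL2R_def)
qed

text \<open>Stated for an arbitrary predicate because it serves twice: for SL(2,R) and for the
  lattice.\<close>

lemma rep_image_induct_closed:
  assumes "A \<in> rep_image M" "P cI"
    and "\<And>A B. P A \<Longrightarrow> P B \<Longrightarrow> P (A ** B)"
    and "\<And>A. P A \<Longrightarrow> P (matrix_inv A)"
    and "\<And>j. j \<in> {1..4} \<Longrightarrow> P (M j)"
  shows "P A"
  using assms(1) by induction (use assms(2-) in auto)

section \<open>Diagonalisation and orders\<close>

lemma conjugate_mat_cdiag:
  assumes det: "det M = l * m" and tr: "trace M = l + m" and "l \<noteq> m" and nz: "M $ 2 $ 1 \<noteq> 0"
  shows "conjugate_mat M (cdiag l m)"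
proof -
  \<comment> \<open>The columns are eigenvectors of \<open>M\<close> for \<open>l\<close> and
    \<open>m\<close>; they are independent because the determinant is
    \<open>(l - m) * M$2$1\<close>.\<close>
  define P :: cmat where
    "P = (\<chi> i j. if i = 1 then (if j = 1 then l else m) - M$2$2 else M$2$1)"
  have "det P \<noteq> 0"
    using nz \<open>l \<noteq> m\<close> by (simp add: P_def det_2 field_simps)
  then have inv: "invertible P" by (simp add: invertible_det_nz)
  then have PI: "P ** matrix_inv P = mat 1"
    unfolding invertible_def matrix_inv_def by (rule someI2_ex) simp
  have t: "M$1$1 = l + m - M$2$2"
    using tr by (simp add: trace_def sum_2 algebra_simps)
  have d: "M$1$2 * M$2$1 = (l + m - M$2$2) * M$2$2 - l * m"
    using det by (simp add: det_2 t algebra_simps)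
  have "M ** P = P ** cdiag l m"
    by (simp add: vec_eq_iff forall_2 P_def cdiag_def matrix_matrix_mult_def sum_2 t d)
       (simp add: algebra_simps)
  then have "M ** P ** matrix_inv P = P ** cdiag l m ** matrix_inv P" by simp
  then have "M = P ** cdiag l m ** matrix_inv P"
    by (simp add: matrix_mul_assoc[symmetric] PI)
  then show ?thesis using inv unfolding conjugate_mat_def by blast
qed

lemma mpow_cdiag: "mpow (cdiag l m) n = cdiag (l ^ n) (m ^ n)"
  by (induction n)
     (auto simp: vec_eq_iff forall_2 cdiag_def cI_def mat_def matrix_matrix_mult_def sum_2)

lemma mpow_conjugate:
  assumes "invertible P"
  shows "mpow (P ** B ** matrix_inv P) n = P ** mpow B n ** matrix_inv P"
proof -
  have PI: "P ** matrix_inv P = mat 1 \<and> matrix_inv P ** P = mat 1"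
    using assms unfolding invertible_def matrix_inv_def by (rule someI_ex)
  show ?thesis
  proof (induction n)
    case 0
    then show ?case using PI by (simp add: cI_def)
  next
    case (Suc n)
    have "P ** B ** matrix_inv P ** (P ** mpow B n ** matrix_inv P)
        = P ** B ** (matrix_inv P ** P) ** mpow B n ** matrix_inv P"
      by (simp only: matrix_mul_assoc)
    then show ?case using Suc PI by (simp add: matrix_mul_assoc)
  qed
qed

lemma has_order_conjugate:
  assumes "conjugate_mat A B"
  shows "has_order A k \<longleftrightarrow> has_order B k"
proof -
  obtain P where inv: "invertible P" and A: "A = P ** B ** matrix_inv P"
    using assms by (auto simp: conjugate_mat_def)
  have PI: "P ** matrix_inv P = mat 1 \<and> matrix_inv P ** P = mat 1"
    using inv unfolding invertible_def matrix_inv_def by (rule someI_ex)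
  have "mpow A n = cI \<longleftrightarrow> mpow B n = cI" for n
  proof
    assume "mpow A n = cI"
    then have "matrix_inv P ** (P ** mpow B n ** matrix_inv P) ** P = matrix_inv P ** cI ** P"
      by (simp add: A mpow_conjugate[OF inv])
    then have "(matrix_inv P ** P) ** mpow B n ** (matrix_inv P ** P) = matrix_inv P ** P"
      by (simp only: matrix_mul_assoc cI_mult)
    then show "mpow B n = cI" by (simp only: PI matrix_mul_lid matrix_mul_rid cI_def)
  next
    assume "mpow B n = cI"
    then show "mpow A n = cI"
      using PI by (simp add: A mpow_conjugate[OF inv] cI_def)
  qed
  then show ?thesis by (simp add: has_order_def)
qed

lemma cis_power_eq_1_iff:
  "cis (3 * pi / 5) ^ n = 1 \<longleftrightarrow> 10 dvd n"
proof -
  have "cis (3 * pi / 5) ^ n = exp (\<i> * of_real (real n * (3 * pi / 5)))"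
    by (simp only: Complex.DeMoivre flip: cis_conv_exp)
  also have "\<dots> = 1 \<longleftrightarrow> (\<exists>k::int. real n * (3 * pi / 5) = of_int (2 * k) * pi)"
    by (simp only: exp_eq_1) simp
  also have "\<dots> \<longleftrightarrow> (\<exists>k::int. 3 * int n = 10 * k)"
  proof -
    have "real n * (3 * pi / 5) = of_int (2 * k) * pi \<longleftrightarrow> 3 * int n = 10 * k" for k
    proof -
      have "real n * (3 * pi / 5) = of_int (2 * k) * pi \<longleftrightarrow> real n * 3 = 10 * of_int k"
        by (simp add: field_simps)
      also have "\<dots> \<longleftrightarrow> real_of_int (3 * int n) = of_int (10 * k)" by (simp add: mult.commute)
      finally show ?thesis by (simp only: of_int_eq_iff)
    qed
    then show ?thesis by simp
  qed
  \<comment> \<open>3 and 10 are coprime.\<close>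
  also have "\<dots> \<longleftrightarrow> 10 dvd n" by presburger
  finally show ?thesis .
qed

lemma has_order_cdiag_cis:
  "has_order (cdiag (cis (3 * pi / 5)) (cnj (cis (3 * pi / 5)))) 10"
proof -
  let ?l = "cis (3 * pi / 5)"
  have "mpow (cdiag ?l (cnj ?l)) n = cI \<longleftrightarrow> ?l ^ n = 1 \<and> cnj ?l ^ n = 1" for n
    unfolding mpow_cdiag by (auto simp: vec_eq_iff forall_2 cdiag_def cI_def mat_def)
  moreover have "cnj ?l ^ n = 1 \<longleftrightarrow> ?l ^ n = 1" for n
    by (metis complex_cnj_cnj complex_cnj_one complex_cnj_power)
  ultimately show ?thesis
    by (auto simp: has_order_def cis_power_eq_1_iff dest: dvd_imp_le)
qed

section \<open>Reflections in the Hermitian model\<close>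

lemma det_hermitian_real:
  assumes "hermitian X" shows "det X \<in> \<real>"
proof -
  obtain c d x y where X: "X = quat c d x y" by (rule quat_surj)
  have "cnj (det X) = det (adjoint X)"
    by (simp add: X adjoint_quat det_quat)
  with assms show ?thesis
    by (simp add: hermitian_iff_adjoint Reals_cnj_iff)
qed

lemma hermitian_add: "hermitian X \<Longrightarrow> hermitian Y \<Longrightarrow> hermitian (X + Y)"
  by (simp add: hermitian_iff_adjoint adjoint_def vec_eq_iff)

lemma det_unit_normal:
  assumes "hermitian N" "mink N N = 1"
  shows "det N = -1"
proof -
  obtain c d x y where N: "N = quat c d x y" by (rule quat_surj)
  have "mink N N = - Re (det N)"
    unfolding mink_def N quat_add det_quat by (simp add: power2_eq_square field_simps)
  moreover have "det N = of_real (Re (det N))"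
    using det_hermitian_real[OF assms(1)] by simp
  ultimately show ?thesis using assms(2) by simp
qed

text \<open>Polarising \<open>X cof X = det X\<close> gives \<open>N cof X + X cof N = -2 \<langle>X,N\<rangle>\<close>;
  multiply by \<open>N\<close> on the right.\<close>

lemma mreflect_eq_cof:
  assumes "hermitian N" "mink N N = 1" "hermitian X"
  shows "mreflect N X = N ** cof X ** N"
proof -
  define t where "t = det X + det N - det (X + N)"
  have "t \<in> \<real>"
    unfolding t_def using assms by (intro Reals_add Reals_diff det_hermitian_real hermitian_add)
  moreover have "2 * mink X N = Re t"
    by (simp add: mink_def t_def)
  ultimately have t: "of_real (2 * mink X N) = t" by simp
  have "N ** cof X = quat (- t) 0 0 0 - X ** cof N"
    unfolding t_def
    by (rule quat_surj[of N], rule quat_surj[of X])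
       (simp only: cof_quat quat_mult quat_add quat_diff det_quat, rule quat_eqI;
        simp add: algebra_simps power2_eq_square)
  then have "N ** cof X ** N = quat (- t) 0 0 0 ** N - X ** (cof N ** N)"
    by (simp add: matrix_diff_mult matrix_mul_assoc)
  also have "cof N ** N = quat (- 1) 0 0 0"
    using mult_cof[of "cof N"] by (simp add: det_unit_normal[OF assms(1,2)])
  also have "quat (- t) 0 0 0 ** N = - ((2 * mink X N) *\<^sub>R N)"
    unfolding t[symmetric]
    by (simp add: vec_eq_iff forall_2 matrix_matrix_mult_def sum_2) (simp add: scaleR_conv_of_real)
  also have "X ** quat (- 1) 0 0 0 = - X"
    by (rule quat_surj[of X]) (simp add: quat_mult quat_uminus)
  finally show ?thesis by (simp add: mreflect_def)
qed

lemma hermitian_mreflect: "hermitian N \<Longrightarrow> hermitian X \<Longrightarrow> hermitian (mreflect N X)"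
  by (simp add: hermitian_iff_adjoint adjoint_def mreflect_def vec_eq_iff)

text \<open>Since \<open>cof\<close> reverses products, \<open>cof (N ** cof X ** N)\<close> is
  \<open>cof N ** X ** cof N\<close>. As \<open>M\<close> and \<open>N\<close> are Hermitian, the
  right factor \<open>cof N ** M\<close> is the adjoint of the left one.\<close>

lemma mreflect_mreflect:
  assumes "hermitian M" "mink M M = 1" "hermitian N" "mink N N = 1" "hermitian X"
  shows "mreflect M (mreflect N X) = (M ** cof N) ** X ** adjoint (M ** cof N)"
proof -
  have "adjoint (M ** cof N) = cof N ** M"
    using assms by (simp add: adjoint_mult adjoint_cof hermitian_iff_adjoint)
  moreover have "mreflect M (mreflect N X) = M ** cof (N ** cof X ** N) ** M"
    using mreflect_eq_cof[OF assms(1,2) hermitian_mreflect[OF assms(3,5)]]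
      mreflect_eq_cof[OF assms(3-5)] by simp
  ultimately show ?thesis
    by (simp only: cof_mult cof_cof matrix_mul_assoc)
qed

lemma mreflect_involution:
  assumes "hermitian N" "mink N N = 1" "hermitian X"
  shows "mreflect N (mreflect N X) = X"
proof -
  have 1: "N ** cof N = - cI"
    by (simp add: mult_cof det_unit_normal[OF assms(1,2)] cI_quat quat_uminus)
  obtain c d x y where X: "X = quat c d x y" by (rule quat_surj)
  show ?thesis
    unfolding mreflect_mreflect[OF assms(1,2,1,2,3)] 1
    by (simp add: X quat_mult cI_quat quat_uminus adjoint_quat)
qed

section \<open>The lattice\<close>

lemma refl_word_append: "refl_word N (v @ w) = refl_word N v \<circ> refl_word N w"
  by (induction v) (simp_all add: refl_word_def comp_assoc)

lemma refl_word_Cons: "refl_word N (i # w) X = mreflect (N i) (refl_word N w X)"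
  by (simp add: refl_word_def)

lemma refl_word_Nil [simp]: "refl_word N [] X = X"
  by (simp add: refl_word_def)

lemma cI_in_Gamma: "cI \<in> Gamma_lattice N"
proof -
  have "in_SL2C cI" "adjoint cI = cI"
    by (simp_all add: in_SL2C_def cI_quat det_quat adjoint_quat)
  then show ?thesis
    by (auto simp: Gamma_lattice_def intro!: exI[of _ "[]"])
qed

text \<open>Minus the identity is in the kernel of the double cover, so lifts have to be identified
  only up to sign.\<close>

lemma uminus_in_Gamma:
  assumes "A \<in> Gamma_lattice N"
  shows "- A \<in> Gamma_lattice N"
proof -
  have "det (- A) = det A" by (simp add: det_2)
  moreover have "(- A) ** X ** adjoint (- A) = A ** X ** adjoint A" for X
    by (simp add: vec_eq_iff adjoint_def matrix_matrix_mult_def sum_negf)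
  ultimately show ?thesis
    using assms by (simp add: Gamma_lattice_def in_SL2C_def)
qed

lemma mult_in_Gamma:
  assumes "A \<in> Gamma_lattice N" "B \<in> Gamma_lattice N"
  shows "A ** B \<in> Gamma_lattice N"
proof -
  obtain v where v: "set v \<subseteq> {0..<4}" "even (length v)"
      "\<And>X. hermitian X \<Longrightarrow> A ** X ** adjoint A = refl_word N v X"
    using assms(1) by (auto simp: Gamma_lattice_def)
  obtain w where w: "set w \<subseteq> {0..<4}" "even (length w)"
      "\<And>X. hermitian X \<Longrightarrow> B ** X ** adjoint B = refl_word N w X"
    using assms(2) by (auto simp: Gamma_lattice_def)
  have "(A ** B) ** X ** adjoint (A ** B) = refl_word N (v @ w) X" if "hermitian X" for X
  proof -
    have "(A ** B) ** X ** adjoint (A ** B) = A ** (B ** X ** adjoint B) ** adjoint A"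
      by (simp add: adjoint_mult matrix_mul_assoc)
    then show ?thesis
      using that v(3) w(3) hermitian_congruence[OF that, of B] by (simp add: refl_word_append)
  qed
  moreover have "set (v @ w) \<subseteq> {0..<4}" "even (length (v @ w))"
    using v w by simp_all
  ultimately show ?thesis
    using assms in_SL2C_mult unfolding Gamma_lattice_def by blast
qed

lemma refl_word_rev:
  assumes "tetrahedron_normals N" "set w \<subseteq> {0..<4}" "hermitian X"
  shows "refl_word N (rev w) (refl_word N w X) = X"
  using assms(2)
proof (induction w)
  case (Cons i w)
  have "hermitian (refl_word N w X)"
    using Cons.prems assms
    by (induction w) (auto simp: refl_word_Cons tetrahedron_normals_def intro: hermitian_mreflect)
  then show ?case
    using Cons assms(1)
    by (simp add: refl_word_append refl_word_Cons mreflect_involution tetrahedron_normals_def)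
qed simp

lemma matrix_inv_in_Gamma:
  assumes "tetrahedron_normals N" "A \<in> Gamma_lattice N"
  shows "matrix_inv A \<in> Gamma_lattice N"
proof -
  obtain w where A: "in_SL2C A" and w: "set w \<subseteq> {0..<4}" "even (length w)"
      "\<And>X. hermitian X \<Longrightarrow> A ** X ** adjoint A = refl_word N w X"
    using assms(2) by (auto simp: Gamma_lattice_def)
  let ?B = "matrix_inv A"
  have "?B ** X ** adjoint ?B = refl_word N (rev w) X" if "hermitian X" for X
  proof -
    \<comment> \<open>This is the preimage of \<open>X\<close> under the action of \<open>A\<close>:
      the word \<open>w\<close> sends it to \<open>X\<close>, and the reversed word brings it
      back.\<close>
    let ?Y = "?B ** X ** adjoint ?B"
    have Y: "hermitian ?Y" by (rule hermitian_congruence[OF that])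
    have "adjoint ?B ** adjoint A = cI"
      by (simp add: in_SL2C_inv[OF A] cI_quat adjoint_quat flip: adjoint_mult)
    moreover have "A ** ?Y ** adjoint A = (A ** ?B) ** X ** (adjoint ?B ** adjoint A)"
      by (simp only: matrix_mul_assoc)
    ultimately have "A ** ?Y ** adjoint A = X"
      by (simp add: in_SL2C_inv[OF A])
    then have "refl_word N w ?Y = X" using w(3)[OF Y] by simp
    then show ?thesis using refl_word_rev[OF assms(1) w(1) Y] by simp
  qed
  moreover have "set (rev w) \<subseteq> {0..<4}" "even (length (rev w))"
    using w by simp_all
  ultimately show ?thesis
    using in_SL2C_inv(1)[OF A] unfolding Gamma_lattice_def by blast
qed

lemma normal_product_in_Gamma:
  assumes "tetrahedron_normals N" "i < 4" "j < 4"
  shows "N i ** cof (N j) \<in> Gamma_lattice N"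
proof -
  have "hermitian (N i)" "mink (N i) (N i) = 1" "hermitian (N j)" "mink (N j) (N j) = 1"
    using assms by (auto simp: tetrahedron_normals_def)
  moreover from this have "in_SL2C (N i ** cof (N j))"
    by (simp add: in_SL2C_def det_mul det_unit_normal)
  ultimately show ?thesis
    using assms(2,3) mreflect_mreflect[of "N i" "N j"]
    by (auto simp: Gamma_lattice_def refl_word_Cons intro!: exI[of _ "[i, j]"])
qed

section \<open>The golden ratio\<close>

definition phi :: real where "phi = (1 + sqrt 5) / 2"

lemma phi_sq: "phi\<^sup>2 = phi + 1"
proof -
  have "sqrt 5 * sqrt 5 = (5::real)" by simp
  then show ?thesis by (simp add: phi_def power2_eq_square field_simps)
qed

text \<open>Rewrite rules for reducing powers of \<open>phi\<close>; the second form reaches the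
  factors of right-nested products. The rules for \<open>hgap\<close> and \<open>isq2\<close> follow
  the same pattern.\<close>

lemma phi_mult: "phi * phi = phi + 1" "phi * (phi * z) = (phi + 1) * z"
  using phi_sq by (simp_all add: power2_eq_square flip: mult.assoc)

lemma phi_gt: "phi > 3/2"
proof -
  have "sqrt 5 > (2::real)" by (rule real_less_rsqrt) simp
  then show ?thesis by (simp add: phi_def)
qed

lemma cos_pi_fifth: "cos (pi / 5) = phi / 2"
proof -
  define c where "c = cos (pi / 5)"
  have "c > 0" unfolding c_def by (rule cos_gt_zero) (use pi_gt_zero in simp_all)
  \<comment> \<open>The angle t = pi/5 satisfies 3t = pi - 2t, which gives a cubic equation for its
    cosine with the extraneous root -1.\<close>
  have "cos (3 * (pi / 5)) = cos (pi - 2 * (pi / 5))"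
    by (rule arg_cong[of _ _ cos]) simp
  also have "\<dots> = - cos (2 * (pi / 5))"
    by (rule cos_pi_minus)
  finally have "cos (3 * (pi / 5)) = - cos (2 * (pi / 5))" .
  then have "4 * c^3 - 3 * c = - (2 * c\<^sup>2 - 1)"
    by (simp only: cos_treble_cos cos_double_cos c_def)
  then have "(c + 1) * (4 * c\<^sup>2 - 2 * c - 1) = 0"
    by (simp add: algebra_simps power2_eq_square power3_eq_cube)
  with \<open>c > 0\<close> have "4 * c\<^sup>2 - 2 * c - 1 = 0" by simp
  \<comment> \<open>The roots are \<open>phi / 2\<close> and \<open>(1 - phi) / 2\<close>; the
    second is negative.\<close>
  then have "(2 * c - phi) * (2 * c + phi - 1) = 0"
    using phi_sq by (simp add: algebra_simps power2_eq_square)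
  moreover have "2 * c + phi - 1 > 0" using \<open>c > 0\<close> phi_gt by simp
  ultimately show ?thesis by (simp add: c_def)
qed

lemma cos_three_pi_fifth: "cos (3 * pi / 5) = (1 - phi) / 2"
proof -
  have "cos (3 * (pi / 5)) = 4 * (phi / 2)^3 - 3 * (phi / 2)"
    by (simp only: cos_treble_cos cos_pi_fifth)
  also have "\<dots> = (phi * phi\<^sup>2 - 3 * phi) / 2"
    by (simp add: power2_eq_square power3_eq_cube field_simps)
  also have "\<dots> = (phi\<^sup>2 - 2 * phi) / 2"
    by (simp add: phi_sq algebra_simps power2_eq_square[symmetric])
  finally show ?thesis by (simp add: phi_sq)
qed

text \<open>Half the difference of the diagonal entries of \<open>g02\<close>. As
  \<open>aa / 2 + 1 / aa = phi\<close>, every entry of \<open>g02\<close> is, up to sign,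
  \<open>phi / 2 - hgap\<close> or \<open>phi / 2 + hgap\<close>.\<close>

definition hgap :: real where "hgap = (1 / aa - aa / 2) / 2"

lemma aa_pos: "aa > 0" and aa_phi: "aa / 2 + 1 / aa = phi"
proof -
  \<comment> \<open>In terms of \<open>s\<close> the inner radical of \<open>aa\<close> becomes
    \<open>2 * s\<close>, so that \<open>aa\<^sup>2\<close> is a polynomial in
    \<open>s\<close>.\<close>
  define s where "s = sqrt phi"
  have s2: "s\<^sup>2 = phi" and s1: "s > 1"
    using phi_gt by (simp_all add: s_def)
  have s4: "s^4 = s\<^sup>2 + 1"
    using phi_sq by (simp add: s2[symmetric] flip: power_mult)
  have "1 + sqrt 5 = 2 * s\<^sup>2" by (simp add: s2 phi_def)
  moreover have "sqrt (2 * (2 * s\<^sup>2)) = 2 * s"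
    using s1 by (intro real_sqrt_unique) (simp_all add: power_mult_distrib)
  ultimately have aa: "aa = sqrt (2 * s\<^sup>2 - 2 * s)" by (simp add: aa_def)
  have pos: "2 * s\<^sup>2 - 2 * s > 0" using s1 by (simp add: power2_eq_square)
  then show "aa > 0" by (simp add: aa)
  have a2: "aa\<^sup>2 = 2 * s\<^sup>2 - 2 * s" using pos by (simp add: aa)
  \<comment> \<open>The claim with denominators cleared, then squared: an identity in
    \<open>s\<close> modulo \<open>s^4 = s\<^sup>2 + 1\<close>. Positivity of both sides allows the
    root to be taken afterwards.\<close>
  have "(aa\<^sup>2 + 2)\<^sup>2 = (2 * phi * aa)\<^sup>2"
  proof -
    have s5: "s^5 = s^3 + s" and s6: "s^6 = 2 * s\<^sup>2 + 1"
      using arg_cong[OF s4, of "\<lambda>x. s * x"] arg_cong[OF s4, of "\<lambda>x. s\<^sup>2 * x"] s4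
      by (simp_all add: eval_nat_numeral algebra_simps)
    have "(aa\<^sup>2 + 2)\<^sup>2 = 4 * (s^4 - 2 * s^3 + 3 * s\<^sup>2 - 2 * s + 1)"
      unfolding a2 by (simp add: eval_nat_numeral algebra_simps)
    also have "\<dots> = 8 * (s^6 - s^5)" unfolding s5 s6 s4 by simp
    also have "\<dots> = 4 * (s\<^sup>2)\<^sup>2 * (2 * s\<^sup>2 - 2 * s)"
      by (simp add: eval_nat_numeral algebra_simps)
    also have "\<dots> = (2 * phi * aa)\<^sup>2" by (simp only: power_mult_distrib a2 s2) simp
    finally show ?thesis .
  qed
  then have "aa\<^sup>2 + 2 = 2 * phi * aa"
    using phi_gt \<open>aa > 0\<close> by (subst (asm) power2_eq_iff_nonneg) simp_all
  then show "aa / 2 + 1 / aa = phi"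
    using \<open>aa > 0\<close> by (simp add: field_simps power2_eq_square)
qed

lemma hgap_sq: "hgap\<^sup>2 = (phi - 1) / 4"
proof -
  have "4 * hgap\<^sup>2 = (aa / 2 + 1 / aa)\<^sup>2 - 2 * (aa * (1 / aa))"
    by (simp only: hgap_def power_divide power2_diff power2_sum) simp
  moreover have "aa * (1 / aa) = 1" using aa_pos by simp
  ultimately have "4 * hgap\<^sup>2 = (aa / 2 + 1 / aa)\<^sup>2 - 2" by simp
  then show ?thesis by (simp add: aa_phi phi_sq)
qed

lemma hgap_mult: "hgap * hgap = (phi - 1) / 4" "hgap * (hgap * z) = (phi - 1) / 4 * z"
  using hgap_sq by (simp_all add: power2_eq_square flip: mult.assoc)

section \<open>The generators\<close>

lemma g02_quat: "g02 = quat (- phi / 2) (phi / 2) hgap (- hgap)"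
  unfolding aa_phi[symmetric] hgap_def
  by (simp add: g02_def vec_eq_iff forall_2 complex_eq_iff inverse_eq_divide diff_divide_distrib
        add_divide_distrib)

definition isq2 :: real where "isq2 = 1 / sqrt 2"

lemma isq2_mult: "isq2 * isq2 = 1 / 2" "isq2 * (isq2 * z) = z / 2"
  by (simp_all add: isq2_def flip: mult.assoc)

lemma of_real_isq2_mult:
  "complex_of_real isq2 * complex_of_real isq2 = 1 / 2"
  "complex_of_real isq2 * (complex_of_real isq2 * z) = z / 2"
proof -
  show "complex_of_real isq2 * complex_of_real isq2 = 1 / 2"
    by (simp only: isq2_mult flip: of_real_mult) simp
  then show "complex_of_real isq2 * (complex_of_real isq2 * z) = z / 2"
    by (simp flip: mult.assoc)
qed

lemma j0_quat: "j0 = quat isq2 isq2 0 0"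
  by (simp add: j0_def isq2_def vec_eq_iff forall_2)

lemma j0_SL2C: "in_SL2C j0"
  by (simp add: in_SL2C_def j0_quat det_quat power2_eq_square of_real_isq2_mult)

lemma j0_conj_quat: "j0 ** quat c d x y ** matrix_inv j0 = quat c d (- y) x"
  unfolding matrix_inv_cof[OF j0_SL2C]
  by (simp add: j0_quat cof_quat quat_mult)
     (rule quat_eqI; simp add: algebra_simps of_real_isq2_mult)

text \<open>The common shape of the four matrices; \<open>(1 - phi) / 2\<close> is
  \<open>cos (3 * pi / 5)\<close>, half their trace.\<close>

definition Jquat :: "real \<Rightarrow> real \<Rightarrow> cmat" where
  "Jquat x y = quat ((1 - phi) / 2) ((1 + phi) / 2) x y"

lemma Jmat_Jquat:
  defines "m \<equiv> phi * hgap"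
  shows "Jmat 1 = Jquat m (- m)" "Jmat 2 = Jquat m m" "Jmat 3 = Jquat (- m) m"
    "Jmat 4 = Jquat (- m) (- m)"
proof -
  have "- (g02 ** g02) = Jquat m (- m)"
    unfolding g02_quat quat_mult quat_uminus Jquat_def m_def
    by (rule quat_eqI; simp add: complex_eq_iff field_simps phi_mult hgap_mult)
  then show 1: "Jmat 1 = Jquat m (- m)" by simp
  \<comment> \<open>Each conjugation by \<open>j0\<close> sends \<open>(x, y)\<close> to
    \<open>(- y, x)\<close>.\<close>
  show 2: "Jmat 2 = Jquat m m"
    using 1 by (simp add: numeral_eq_Suc Jquat_def j0_conj_quat)
  show 3: "Jmat 3 = Jquat (- m) m"
    using 2 by (simp add: numeral_eq_Suc Jquat_def j0_conj_quat)
  show "Jmat 4 = Jquat (- m) (- m)"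
    using 3 by (simp add: numeral_eq_Suc Jquat_def j0_conj_quat)
qed

lemma phi_hgap_sq: "(phi * hgap)\<^sup>2 = phi / 4"
  by (simp add: power_mult_distrib hgap_sq phi_sq) (simp add: algebra_simps phi_mult)

lemma Jmat_cases:
  assumes "j \<in> {1..4}"
  obtains x y where "Jmat j = Jquat x y" "x\<^sup>2 = phi / 4" "y\<^sup>2 = phi / 4"
proof -
  have "j = 1 \<or> j = 2 \<or> j = 3 \<or> j = 4" using assms by auto
  then show ?thesis
    using that Jmat_Jquat phi_hgap_sq by (metis power2_minus)
qed

lemma Jquat_SL2R:
  assumes "x\<^sup>2 = phi / 4" "y\<^sup>2 = phi / 4"
  shows "in_SL2R (Jquat x y)"
proof -
  have "((1 - phi) / 2)\<^sup>2 + ((1 + phi) / 2)\<^sup>2 - x\<^sup>2 - y\<^sup>2 = 1"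
    unfolding assms by (simp add: power2_eq_square field_simps phi_mult)
  then have "complex_of_real (((1 - phi) / 2)\<^sup>2 + ((1 + phi) / 2)\<^sup>2 - x\<^sup>2 - y\<^sup>2) = 1"
    by simp
  then have "det (Jquat x y) = 1"
    unfolding Jquat_def det_quat by (simp only: of_real_add of_real_diff of_real_power)
  then show ?thesis by (simp add: in_SL2R_def forall_2 Jquat_def)
qed

lemma Jmat_SL2R: "j \<in> {1..4} \<Longrightarrow> in_SL2R (Jmat j)"
  by (metis Jmat_cases Jquat_SL2R)

lemma Jmat_conjugate:
  assumes "j \<in> {1..4}"
  shows "conjugate_mat (Jmat j) (cdiag (cis (3 * pi / 5)) (cnj (cis (3 * pi / 5))))"
proof -
  let ?l = "cis (3 * pi / 5)"
  obtain x y where J: "Jmat j = Jquat x y" and y: "y\<^sup>2 = phi / 4"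
    using assms by (rule Jmat_cases)
  show ?thesis
  proof (rule conjugate_mat_cdiag)
    show "det (Jmat j) = ?l * cnj ?l"
      using Jmat_SL2R[OF assms] by (simp add: in_SL2R_def cis_cnj cis_mult)
    show "trace (Jmat j) = ?l + cnj ?l"
      by (simp add: J Jquat_def trace_quat complex_eq_iff cos_three_pi_fifth)
    have "sin (3 * pi / 5) > 0"
      by (rule sin_gt_zero) (use pi_gt_zero in simp_all)
    then show "?l \<noteq> cnj ?l" by (simp add: complex_eq_iff)
    \<comment> \<open>The lower left entry is \<open>y + (1 + phi) / 2\<close>; its vanishing would
      force \<open>(1 + phi)\<^sup>2 = phi\<close>.\<close>
    have "y \<noteq> - ((1 + phi) / 2)"
    proof
      assume "y = - ((1 + phi) / 2)"
      then have "(1 + phi)\<^sup>2 / 4 = phi / 4"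
        using y by (simp add: power_divide)
      then show False
        using phi_gt phi_sq by (simp add: power2_eq_square algebra_simps)
    qed
    then have "complex_of_real (y + (1 + phi) / 2) \<noteq> 0" unfolding of_real_eq_0_iff by linarith
    then show "Jmat j $ 2 $ 1 \<noteq> 0"
      by (simp add: J Jquat_def)
  qed
qed

text \<open>The first two coefficients of \<open>Jquat\<close> have sum 1 and difference
  \<open>- phi\<close>, so the difference of their squares is \<open>- phi\<close>.\<close>

lemma trace_Jquat_mult:
  "trace (Jquat x y ** Jquat x' y') = of_real (2 * (x * x' + y * y') - 2 * phi)"
  by (simp add: Jquat_def quat_mult trace_quat complex_eq_iff field_simps)

lemma Jmat_relation: "Jmat 4 ** Jmat 3 ** Jmat 2 ** Jmat 1 = cI"
proof -
  define m where "m = phi * hgap"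
  have "m * m = phi / 4"
    using phi_hgap_sq by (simp add: m_def power2_eq_square)
  then have m: "m * m = phi / 4" "m * (m * z) = phi / 4 * z" for z
    by (simp_all flip: mult.assoc)
  \<comment> \<open>The two partial products are diagonal and adjugate to each other, with
    determinant \<open>phi\<^sup>2 - 4 * (m * m) = 1\<close>.\<close>
  have 1: "Jmat 4 ** Jmat 3 = quat (- phi) 0 (- 2 * m) 0"
    unfolding Jmat_Jquat m_def[symmetric] Jquat_def quat_mult
    by (rule quat_eqI; simp add: complex_eq_iff field_simps m phi_mult)
  have 2: "Jmat 2 ** Jmat 1 = quat (- phi) 0 (2 * m) 0"
    unfolding Jmat_Jquat m_def[symmetric] Jquat_def quat_mult
    by (rule quat_eqI; simp add: complex_eq_iff field_simps m phi_mult)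
  have "Jmat 4 ** Jmat 3 ** Jmat 2 ** Jmat 1 = (Jmat 4 ** Jmat 3) ** (Jmat 2 ** Jmat 1)"
    by (simp only: matrix_mul_assoc)
  also have "\<dots> = cI"
    unfolding 1 2 quat_mult cI_quat
    by (rule quat_eqI; simp add: complex_eq_iff field_simps m phi_mult)
  finally show ?thesis .
qed

text \<open>Eliminating \<open>c\<close> says that \<open>v\<close> and its image are parallel. This
  is a quadratic equation in \<open>v\<close> from which the trace part drops out.\<close>

lemma eigenvector_Jquat:
  assumes "Jquat x y *v v = c *s v"
  shows "2 * x * v$1 * v$2 + y * ((v$2)\<^sup>2 - (v$1)\<^sup>2) = (1 + phi) / 2 * ((v$1)\<^sup>2 + (v$2)\<^sup>2)"
proof -
  let ?a = "complex_of_real ((1 - phi) / 2)" and ?d = "complex_of_real ((1 + phi) / 2)"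
  have "(?a + x) * v$1 + (y - ?d) * v$2 = c * v$1" "(y + ?d) * v$1 + (?a - x) * v$2 = c * v$2"
    using assms
    by (simp_all only: Jquat_def vec_eq_iff forall_2 matrix_vector_mult_def sum_2 quat_nth
          vec_lambda_beta vector_smult_component)
  then have "((?a + x) * v$1 + (y - ?d) * v$2) * v$2 = ((y + ?d) * v$1 + (?a - x) * v$2) * v$1"
    by simp
  then have "2 * x * v$1 * v$2 + y * ((v$2)\<^sup>2 - (v$1)\<^sup>2) = ?d * ((v$1)\<^sup>2 + (v$2)\<^sup>2)"
    by (simp add: algebra_simps power2_eq_square)
  then show ?thesis by simp
qed

lemma Jmat_irreducible: "irreducible_rep Jmat"
  unfolding irreducible_rep_def
proof clarify
  fix v :: "complex^2"
  assume "v \<noteq> 0" and ev: "\<forall>j\<in>{1..4}. \<exists>c. Jmat j *v v = c *s v"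
  define m where "m = phi * hgap"
  have "m \<noteq> 0" using phi_hgap_sq phi_gt by (auto simp: m_def)
  have "\<exists>c. Jmat 1 *v v = c *s v" "\<exists>c. Jmat 2 *v v = c *s v" "\<exists>c. Jmat 3 *v v = c *s v"
    using ev by (auto simp del: Jmat.simps)
  then obtain c1 c2 c3 where
    "Jmat 1 *v v = c1 *s v" "Jmat 2 *v v = c2 *s v" "Jmat 3 *v v = c3 *s v"
    by blast
  note e = this[unfolded Jmat_Jquat m_def[symmetric], THEN eigenvector_Jquat]
  \<comment> \<open>The right-hand sides of the three equations agree; subtracting the first and the
    third from the second isolates one term each.\<close>
  have "m * ((v$2)\<^sup>2 - (v$1)\<^sup>2) = 0" "m * v$1 * v$2 = 0"
    using e by (simp_all only: of_real_minus) algebra+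
  then have "(v$2)\<^sup>2 = (v$1)\<^sup>2" "v$1 * v$2 = 0"
    using \<open>m \<noteq> 0\<close> by simp_all
  then have "v$1 = 0" "v$2 = 0" by auto
  then show False using \<open>v \<noteq> 0\<close> by (simp add: vec_eq_iff forall_2)
qed

lemma Jmat_rep: "is_rep Jmat"
  using Jmat_SL2R Jmat_relation by (auto simp: is_rep_def in_SL2C_def in_SL2R_def)

lemma Jmat_image_SL2R:
  assumes "A \<in> rep_image Jmat"
  shows "in_SL2R A"
proof (rule rep_image_induct_closed[OF assms, where P = in_SL2R])
  show "in_SL2R cI" by (simp add: in_SL2R_def cI_def mat_def forall_2 det_2)
qed (auto simp: in_SL2R_mult in_SL2R_inv Jmat_SL2R)

lemma Jmat_RSR: "RSR Jmat"
proof -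
  have m: "(phi * hgap) * (phi * hgap) = phi / 4"
    using phi_hgap_sq by (simp add: power2_eq_square)
  have t12: "trace (Jmat 1 ** Jmat 2) = of_real (- 2 * phi)"
    and t23: "trace (Jmat 2 ** Jmat 3) = of_real (- 2 * phi)"
    and t13: "trace (Jmat 1 ** Jmat 3) = of_real (- 3 * phi)"
    and t24: "trace (Jmat 2 ** Jmat 4) = of_real (- 3 * phi)"
    unfolding Jmat_Jquat trace_Jquat_mult of_real_eq_iff minus_mult_minus mult_minus_left
      mult_minus_right m
    by simp_all
  \<comment> \<open>The rotation parameter is 3/10, as 2 pi 3/10 = 3 pi/5; it lies between 1/4 and
    1/2.\<close>
  have "exp (2 * pi * \<i> * of_real (3/10)) = cis (3 * pi / 5)"
    "exp (- 2 * pi * \<i> * of_real (3/10)) = cnj (cis (3 * pi / 5))"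
    by (simp_all add: cis_conv_exp exp_cnj) (simp_all add: mult_ac)
  then have "\<exists>r::real. 1/4 < r \<and> r < 1/2 \<and>
          (\<forall>j\<in>{1..4}. conjugate_mat (Jmat j)
              (cdiag (exp (2 * pi * \<i> * of_real r)) (exp (- 2 * pi * \<i> * of_real r))))"
    using Jmat_conjugate by (intro exI[of _ "3/10"]) (simp only:, simp)
  then show ?thesis
    unfolding RSR_def t12 t23 t13 t24
    using Jmat_rep Jmat_irreducible Jmat_image_SL2R phi_gt by simp
qed

lemma Jmat_genus: "has_genus Jmat 4"
  unfolding has_genus_def
  using has_order_conjugate[OF Jmat_conjugate] has_order_cdiag_cis
  \<comment> \<open>The order 10 is even, so the genus is 10/2 - 1 = 4.\<close>
  by (intro exI[of _ 10]) (simp add: rsr_genus_def)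

section \<open>Normals of the tetrahedron\<close>

text \<open>The real matrices preserve the hyperbolic plane orthogonal to \<open>N 3\<close>, which carries the
  tessellation of type (5,4). In its triangle group, \<open>g02\<close> is the product of the reflections in
  \<open>N 0\<close> and \<open>N 1\<close>, and \<open>j0\<close> the product of those in \<open>S\<close> and \<open>N 1\<close>, where
  \<open>S = [[1,0],[0,-1]]\<close> is the mirror image of \<open>N 3\<close> in \<open>N 2\<close>. This fixes the normals up to signs.\<close>

definition tet_normal :: "nat \<Rightarrow> cmat" where
  "tet_normal i =
     (if i = 0 then quat (- 2 * hgap * isq2) 0 0 (- phi * isq2)
      else if i = 1 then quat 0 0 (- isq2) isq2
      else if i = 2 then quat 0 (- \<i> * isq2) isq2 0
      else quat 0 \<i> 0 0)"

lemma mink_quat: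
  "mink (quat c d x y) (quat c' d' x' y') = Re (x * x' + y * y' - c * c' - d * d')"
proof -
  have "det (quat c d x y) + det (quat c' d' x' y') - det (quat c d x y + quat c' d' x' y')
      = 2 * (x * x' + y * y' - c * c' - d * d')"
    unfolding quat_add det_quat by algebra
  then show ?thesis by (simp add: mink_def)
qed

lemma tet_normal_normals: "tetrahedron_normals tet_normal"
proof -
  \<comment> \<open>Only this norm involves the golden ratio:
    \<open>phi\<^sup>2 - 4 * hgap\<^sup>2 = 2\<close>.\<close>
  have N0: "mink (tet_normal 0) (tet_normal 0) = 1"
  proof -
    have "mink (tet_normal 0) (tet_normal 0) = (phi * phi - 4 * (hgap * hgap)) * (isq2 * isq2)"
      by (simp add: tet_normal_def mink_quat algebra_simps)
    then show ?thesis by (simp add: isq2_mult hgap_mult phi_mult field_simps)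
  qed
  \<comment> \<open>This accounts for the angle between faces 2 and 3; the products of adjacent
    normals are \<open>- phi / 2\<close>, \<open>- 1 / 2\<close> and \<open>- isq2\<close>.\<close>
  have "isq2 = cos (pi / 4)" by (simp add: isq2_def cos_45 real_div_sqrt field_simps)
  then have "\<forall>i<4. \<forall>j<4. i \<noteq> j \<longrightarrow> mink (tet_normal i) (tet_normal j) = - cos (tet_angle i j)"
    by (simp add: numeral_eq_Suc All_less_Suc)
       (simp add: tet_normal_def mink_quat tet_angle_def doubleton_eq_iff isq2_mult cos_60 cos_pi_fifth)
  moreover have "\<forall>i<4. hermitian (tet_normal i) \<and> mink (tet_normal i) (tet_normal i) = 1"
    using N0 by (simp add: numeral_eq_Suc All_less_Suc)
       (simp add: tet_normal_def mink_quat isq2_mult hermitian_iff_adjoint adjoint_quat)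
  ultimately show ?thesis by (simp add: tetrahedron_normals_def)
qed

lemma g02_in_Gamma: "g02 \<in> Gamma_lattice tet_normal"
proof -
  have "g02 = - (tet_normal 0 ** cof (tet_normal 1))"
    unfolding g02_quat
    by (simp add: tet_normal_def cof_quat quat_mult quat_uminus)
       (rule quat_eqI; simp add: complex_eq_iff algebra_simps isq2_mult)
  then show ?thesis
    using uminus_in_Gamma[OF normal_product_in_Gamma[OF tet_normal_normals, of 0 1]] by simp
qed

lemma j0_in_Gamma: "j0 \<in> Gamma_lattice tet_normal"
proof -
  \<comment> \<open>The reflection in the mirror image of face 3 in face 2 is the word 2, 3, 2;
    following it by 1 gives the even word 2, 3, 2, 1.\<close>
  have "j0 = (tet_normal 2 ** cof (tet_normal 3)) ** (tet_normal 2 ** cof (tet_normal 1))"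
    unfolding j0_quat
    by (simp add: tet_normal_def cof_quat quat_mult)
       (rule quat_eqI; simp add: complex_eq_iff algebra_simps isq2_mult)
  then show ?thesis
    using mult_in_Gamma[OF normal_product_in_Gamma[OF tet_normal_normals, of 2 3]
        normal_product_in_Gamma[OF tet_normal_normals, of 2 1]] by simp
qed

text \<open>The shift to \<open>Suc k\<close> starts the induction at J1, from where the recursion
  only conjugates by \<open>j0\<close>.\<close>

lemma Jmat_in_Gamma: "Jmat (Suc k) \<in> Gamma_lattice tet_normal"
  by (induction k)
     (simp_all add: g02_in_Gamma j0_in_Gamma mult_in_Gamma uminus_in_Gamma
        matrix_inv_in_Gamma[OF tet_normal_normals])

lemma Jmat_image_in_Gamma: "rep_image Jmat \<subseteq> Gamma_lattice tet_normal"
proof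
  fix A
  assume "A \<in> rep_image Jmat"
  then show "A \<in> Gamma_lattice tet_normal"
  proof (rule rep_image_induct_closed[where P = "\<lambda>A. A \<in> Gamma_lattice tet_normal"])
    fix j :: nat
    assume "j \<in> {1..4}"
    then show "Jmat j \<in> Gamma_lattice tet_normal"
      using Jmat_in_Gamma[of "j - 1"] by simp
  qed (simp_all add: cI_in_Gamma mult_in_Gamma matrix_inv_in_Gamma[OF tet_normal_normals])
qed

theorem theorem6p1:
  shows "is_rep Jmat \<and> RSR Jmat \<and> has_genus Jmat 4 \<and>
         (\<exists>N. tetrahedron_normals N \<and> g02 \<in> Gamma_lattice N \<and> rep_image Jmat \<subseteq> Gamma_lattice N)"
  using Jmat_rep Jmat_RSR Jmat_genus tet_normal_normals g02_in_Gamma Jmat_image_in_Gamma by blast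

end
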